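(* Let $\mathfrak{A}=(A;\vee,\wedge,\odot,\rightarrow,0,1)$ be a residuated lattice. The following assertions are equivalent: (1) $\mathfrak{A}$ is Gelfand; (2) for any distinct maximal filters $\mathfrak{m}$ and $\mathfrak{n}$ of $\mathfrak{A}$, there exist $a\notin \mathfrak{m}$ and $b\notin \mathfrak{n}$ such that $a\vee b=1$; (3) for any distinct maximal filters $\mathfrak{m}$ and $\mathfrak{n}$ of $\mathfrak{A}$, $D(\mathfrak{m})$ and $D(\mathfrak{n})$ are comaximal; (4) for any distinct maximal filters $\mathfrak{m}$ and $\mathfrak{n}$ of $\mathfrak{A}$, there exists $a\in A$ such that $a\in D(\mathfrak{m})$ and $\neg a\in D(\mathfrak{n})$; (5) for any maximal filter $\mathfrak{m}$ and any prime filter $\mathfrak{p}$ of $\mathfrak{A}$, $D(\mathfrak{p})\subseteq \mathfrak{m}$ implies $\mathfrak{p}\subseteq \mathfrak{m}$; (6) for any maximal filter $\mathfrak{m}$ and any proper filter $F$ of $\mathfrak{A}$, $D(\mathfrak{m})\subseteq F$ implies $F\subseteq \mathfrak{m}$; (7) for any maximal filter $\mathfrak{m}$ and any proper filter $F$ of $\mathfrak{A}$, $F\veebar \mathfrak{m}=A$ implies $F\veebar D(\mathfrak{m})=A$; (8) for any maximal filter $\mathfrak{m}$ of $\mathfrak{A}$, $\mathfrak{m}$ is the unique maximal filter containing $D(\mathfrak{m})$; (9) for any maximal filter $\mathfrak{m}$ of $\mathfrak{A}$, $\mathscr{G}(\mathfrak{m})=h(D(\mathfrak{m}))$; (10) for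 any maximal filter $\mathfrak{m}$ of $\mathfrak{A}$, the quotient $\mathfrak{A}/D(\mathfrak{m})$ is local; (11) for any maximal filter $\mathfrak{m}$ of $\mathfrak{A}$ and any $x\notin \mathfrak{m}$, there exist a positive integer $n$ and $a\notin \mathfrak{m}$ such that $a\vee \neg x^{n}=1$.
   Context: A residuated lattice is an algebra $\mathfrak{A}=(A;\vee,\wedge,\odot,\rightarrow,0,1)$ such that $(A;\vee,\wedge,0,1)$ is a bounded lattice, $(A;\odot,1)$ is a commutative monoid, and $x\odot y\le z$ iff $x\le y\rightarrow z$ for all $x,y,z\in A$. Put $\neg a:=a\rightarrow 0$, $a^1=a$, $a^{n+1}=a^n\odot a$; $\neg x^n$ means $\neg(x^n)$. A filter of $\mathfrak{A}$ is a non-empty subset $F\subseteq A$ such that $x,y\in F$ implies $x\odot y\in F$, and $x\in F$, $y\in A$ imply $x\vee y\in F$. $F\veebar G$ denotes the filter generated by $F\cup G$; $F$ and $G$ are comaximal if $F\veebar G=A$. A filter is proper if it is not $A$; a maximal filter is a maximal element (under inclusion) among proper filters; a prime filter is a proper filter $\mathfrak{p}$ such that $x\vee y\in\mathfrak{p}$ implies $x\in\mathfrak{p}$ or $y\in\mathfrak{p}$. $Spec(\mathfrak{A})$ is the set of prime filters; every maximal filter is prime. $\mathfrak{A}$ is Gelfand if every prime filter is contained in a unique maximal filter. For a prime filter $\mathfrak{p}$, $D(\mathfrak{p})=\{a\in A\mid a\vee x=1 \text{ for some } x\in A\setminus\mathfrak{p}\}$, which is a filter of $\mathfrak{A}$.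 For $X\subseteq A$, $h(X)=\{\mathfrak{p}\in Spec(\mathfrak{A})\mid X\subseteq\mathfrak{p}\}$. For a prime filter $\mathfrak{p}$, $\mathscr{G}(\mathfrak{p})=\{\mathfrak{q}\in Spec(\mathfrak{A})\mid \mathfrak{q}\subseteq\mathfrak{p}\}$. For a filter $F$, $\mathfrak{A}/F$ is the quotient residuated lattice by the congruence $x\equiv y$ iff $x\rightarrow y\in F$ and $y\rightarrow x\in F$. A residuated lattice is local if it has exactly one maximal filter. *)

theory Defs
  imports "HOL-Algebra.Group" HOL.Hull
begin

text \<open>
  A residuated lattice is an algebra on an explicit carrier, so that its quotients are again
  objects of the same kind.  The monoid operation, its unit (which is also the top element) and
  the powers of an element are those of the library record of monoids.
\<close>

record 'a rlattice = "'a monoid" +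
  rl_join :: "'a \<Rightarrow> 'a \<Rightarrow> 'a" (infixl "\<^bold>\<or>\<index>" 65)
  rl_meet :: "'a \<Rightarrow> 'a \<Rightarrow> 'a" (infixl "\<^bold>\<and>\<index>" 67)
  rl_imp :: "'a \<Rightarrow> 'a \<Rightarrow> 'a" (infixr "\<^bold>\<rightarrow>\<index>" 60)
  rl_zero :: 'a ("\<^bold>0\<index>")

definition rl_le :: "('a, 'b) rlattice_scheme \<Rightarrow> 'a \<Rightarrow> 'a \<Rightarrow> bool" (infix "\<^bold>\<le>\<index>" 50)
  where "x \<^bold>\<le>\<^bsub>L\<^esub> y \<longleftrightarrow> x \<^bold>\<or>\<^bsub>L\<^esub> y = y"

locale residuated_lattice = comm_monoid L for L (structure) +
  assumes join_closed: "\<lbrakk>x \<in> carrier L; y \<in> carrier L\<rbrakk> \<Longrightarrow> x \<^bold>\<or> y \<in> carrier L"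
    and meet_closed: "\<lbrakk>x \<in> carrier L; y \<in> carrier L\<rbrakk> \<Longrightarrow> x \<^bold>\<and> y \<in> carrier L"
    and imp_closed: "\<lbrakk>x \<in> carrier L; y \<in> carrier L\<rbrakk> \<Longrightarrow> x \<^bold>\<rightarrow> y \<in> carrier L"
    and zero_closed: "\<^bold>0 \<in> carrier L"
    and join_assoc: "\<lbrakk>x \<in> carrier L; y \<in> carrier L; z \<in> carrier L\<rbrakk>
      \<Longrightarrow> (x \<^bold>\<or> y) \<^bold>\<or> z = x \<^bold>\<or> (y \<^bold>\<or> z)"
    and join_comm: "\<lbrakk>x \<in> carrier L; y \<in> carrier L\<rbrakk> \<Longrightarrow> x \<^bold>\<or> y = y \<^bold>\<or> x"
    and meet_assoc: "\<lbrakk>x \<in> carrier L; y \<in> carrier L; z \<in> carrier L\<rbrakk>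
      \<Longrightarrow> (x \<^bold>\<and> y) \<^bold>\<and> z = x \<^bold>\<and> (y \<^bold>\<and> z)"
    and meet_comm: "\<lbrakk>x \<in> carrier L; y \<in> carrier L\<rbrakk> \<Longrightarrow> x \<^bold>\<and> y = y \<^bold>\<and> x"
    and join_meet_absorb: "\<lbrakk>x \<in> carrier L; y \<in> carrier L\<rbrakk> \<Longrightarrow> x \<^bold>\<or> (x \<^bold>\<and> y) = x"
    and meet_join_absorb: "\<lbrakk>x \<in> carrier L; y \<in> carrier L\<rbrakk> \<Longrightarrow> x \<^bold>\<and> (x \<^bold>\<or> y) = x"
    and zero_le: "x \<in> carrier L \<Longrightarrow> \<^bold>0 \<^bold>\<le> x"
    and le_one: "x \<in> carrier L \<Longrightarrow> x \<^bold>\<le> \<one>"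
    and residuation: "\<lbrakk>x \<in> carrier L; y \<in> carrier L; z \<in> carrier L\<rbrakk>
      \<Longrightarrow> x \<otimes> y \<^bold>\<le> z \<longleftrightarrow> x \<^bold>\<le> y \<^bold>\<rightarrow> z"

definition rl_neg :: "('a, 'b) rlattice_scheme \<Rightarrow> 'a \<Rightarrow> 'a" ("\<^bold>\<not>\<index> _" [81] 80)
  where "\<^bold>\<not>\<^bsub>L\<^esub> x = x \<^bold>\<rightarrow>\<^bsub>L\<^esub> \<^bold>0\<^bsub>L\<^esub>"

definition rl_filter :: "('a, 'b) rlattice_scheme \<Rightarrow> 'a set \<Rightarrow> bool"
  where "rl_filter L F \<longleftrightarrow> F \<subseteq> carrier L \<and> F \<noteq> {}
    \<and> (\<forall>x\<in>F. \<forall>y\<in>F. x \<otimes>\<^bsub>L\<^esub> y \<in> F)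
    \<and> (\<forall>x\<in>F. \<forall>y\<in>carrier L. x \<^bold>\<or>\<^bsub>L\<^esub> y \<in> F)"

definition filter_join :: "('a, 'b) rlattice_scheme \<Rightarrow> 'a set \<Rightarrow> 'a set \<Rightarrow> 'a set"
    (infixl "\<^bold>\<squnion>\<index>" 65)
  where "F \<^bold>\<squnion>\<^bsub>L\<^esub> G = rl_filter L hull (F \<union> G)"

definition comaximal :: "('a, 'b) rlattice_scheme \<Rightarrow> 'a set \<Rightarrow> 'a set \<Rightarrow> bool"
  where "comaximal L F G \<longleftrightarrow> F \<^bold>\<squnion>\<^bsub>L\<^esub> G = carrier L"

definition proper_filter :: "('a, 'b) rlattice_scheme \<Rightarrow> 'a set \<Rightarrow> bool"
  where "proper_filter L F \<longleftrightarrow> rl_filter L F \<and> F \<noteq> carrier L"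

definition maximal_filter :: "('a, 'b) rlattice_scheme \<Rightarrow> 'a set \<Rightarrow> bool"
  where "maximal_filter L M \<longleftrightarrow>
    proper_filter L M \<and> (\<forall>F. proper_filter L F \<and> M \<subseteq> F \<longrightarrow> F = M)"

definition prime_filter :: "('a, 'b) rlattice_scheme \<Rightarrow> 'a set \<Rightarrow> bool"
  where "prime_filter L P \<longleftrightarrow> proper_filter L P
    \<and> (\<forall>x\<in>carrier L. \<forall>y\<in>carrier L. x \<^bold>\<or>\<^bsub>L\<^esub> y \<in> P \<longrightarrow> x \<in> P \<or> y \<in> P)"

definition Spec :: "('a, 'b) rlattice_scheme \<Rightarrow> 'a set set"
  where "Spec L = {P. prime_filter L P}"

definition Gelfand :: "('a, 'b) rlattice_scheme \<Rightarrow> bool"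
  where "Gelfand L \<longleftrightarrow> (\<forall>P\<in>Spec L. \<exists>!M. maximal_filter L M \<and> P \<subseteq> M)"

definition D_filter :: "('a, 'b) rlattice_scheme \<Rightarrow> 'a set \<Rightarrow> 'a set"
  where "D_filter L P = {a \<in> carrier L. \<exists>x \<in> carrier L - P. a \<^bold>\<or>\<^bsub>L\<^esub> x = \<one>\<^bsub>L\<^esub>}"

definition spec_hull :: "('a, 'b) rlattice_scheme \<Rightarrow> 'a set \<Rightarrow> 'a set set"
  where "spec_hull L X = {P \<in> Spec L. X \<subseteq> P}"

definition generizations :: "('a, 'b) rlattice_scheme \<Rightarrow> 'a set \<Rightarrow> 'a set set"
  where "generizations L P = {Q \<in> Spec L. Q \<subseteq> P}"

definition rl_cong :: "('a, 'b) rlattice_scheme \<Rightarrow> 'a set \<Rightarrow> ('a \<times> 'a) set"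
  where "rl_cong L F = {(x, y). x \<in> carrier L \<and> y \<in> carrier L
    \<and> x \<^bold>\<rightarrow>\<^bsub>L\<^esub> y \<in> F \<and> y \<^bold>\<rightarrow>\<^bsub>L\<^esub> x \<in> F}"

text \<open>
  The operation on classes induced by an operation on representatives; for a filter the union
  below is a single class, see \<open>lift_op_class\<close>.
\<close>

definition lift_op :: "('a, 'b) rlattice_scheme \<Rightarrow> 'a set \<Rightarrow> ('a \<Rightarrow> 'a \<Rightarrow> 'a)
    \<Rightarrow> 'a set \<Rightarrow> 'a set \<Rightarrow> 'a set"
  where "lift_op L F f X Y = (\<Union>x\<in>X. \<Union>y\<in>Y. rl_cong L F `` {f x y})"

definition rl_quot :: "('a, 'b) rlattice_scheme \<Rightarrow> 'a set \<Rightarrow> 'a set rlattice" (infixl "\<^bold>'/\<^bold>'/" 65)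
  where "L \<^bold>/\<^bold>/ F = \<lparr>
    carrier = carrier L // rl_cong L F,
    monoid.mult = lift_op L F (\<otimes>\<^bsub>L\<^esub>),
    one = rl_cong L F `` {\<one>\<^bsub>L\<^esub>},
    rl_join = lift_op L F (\<^bold>\<or>\<^bsub>L\<^esub>),
    rl_meet = lift_op L F (\<^bold>\<and>\<^bsub>L\<^esub>),
    rl_imp = lift_op L F (\<^bold>\<rightarrow>\<^bsub>L\<^esub>),
    rl_zero = rl_cong L F `` {\<^bold>0\<^bsub>L\<^esub>}\<rparr>"

definition local_rl :: "('a, 'b) rlattice_scheme \<Rightarrow> bool"
  where "local_rl L \<longleftrightarrow> (\<exists>!M. maximal_filter L M)"


text \<open>The quotient by a filter is well defined and is a residuated lattice.\<close>

context residuated_lattice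
begin

lemmas cl = join_closed meet_closed imp_closed zero_closed m_closed one_closed

lemma le_refl: "x \<in> carrier L \<Longrightarrow> x \<^bold>\<le> x"
  unfolding rl_le_def by (metis join_meet_absorb meet_join_absorb cl(1))

lemma le_trans:
  "\<lbrakk>x \<^bold>\<le> y; y \<^bold>\<le> z; x \<in> carrier L; y \<in> carrier L; z \<in> carrier L\<rbrakk> \<Longrightarrow> x \<^bold>\<le> z"
  unfolding rl_le_def by (metis join_assoc)

lemma le_antisym: "\<lbrakk>x \<^bold>\<le> y; y \<^bold>\<le> x; x \<in> carrier L; y \<in> carrier L\<rbrakk> \<Longrightarrow> x = y"
  unfolding rl_le_def by (metis join_comm)

lemma le_join1: "\<lbrakk>x \<in> carrier L; y \<in> carrier L\<rbrakk> \<Longrightarrow> x \<^bold>\<le> x \<^bold>\<or> y"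
  using le_refl[of x] unfolding rl_le_def by (metis join_assoc)

lemma le_join2: "\<lbrakk>x \<in> carrier L; y \<in> carrier L\<rbrakk> \<Longrightarrow> y \<^bold>\<le> x \<^bold>\<or> y"
  by (metis le_join1 join_comm)

lemma join_least:
  "\<lbrakk>x \<^bold>\<le> z; y \<^bold>\<le> z; x \<in> carrier L; y \<in> carrier L; z \<in> carrier L\<rbrakk> \<Longrightarrow> x \<^bold>\<or> y \<^bold>\<le> z"
  unfolding rl_le_def by (metis join_assoc)

lemma meet_le1: "\<lbrakk>x \<in> carrier L; y \<in> carrier L\<rbrakk> \<Longrightarrow> x \<^bold>\<and> y \<^bold>\<le> x"
  unfolding rl_le_def by (metis join_meet_absorb join_comm meet_closed)

lemma meet_le2: "\<lbrakk>x \<in> carrier L; y \<in> carrier L\<rbrakk> \<Longrightarrow> x \<^bold>\<and> y \<^bold>\<le> y"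
  by (metis meet_le1 meet_comm)

lemma le_iff_meet: "\<lbrakk>x \<in> carrier L; y \<in> carrier L\<rbrakk> \<Longrightarrow> x \<^bold>\<le> y \<longleftrightarrow> x \<^bold>\<and> y = x"
  unfolding rl_le_def by (metis join_meet_absorb meet_join_absorb join_comm meet_comm meet_closed)

lemma meet_greatest:
  "\<lbrakk>z \<^bold>\<le> x; z \<^bold>\<le> y; x \<in> carrier L; y \<in> carrier L; z \<in> carrier L\<rbrakk> \<Longrightarrow> z \<^bold>\<le> x \<^bold>\<and> y"
  by (metis le_iff_meet meet_assoc meet_closed)

lemma mult_mono_left:
  assumes "x \<^bold>\<le> y" "x \<in> carrier L" "y \<in> carrier L" "z \<in> carrier L"
  shows "x \<otimes> z \<^bold>\<le> y \<otimes> z"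
proof -
  have "y \<^bold>\<le> z \<^bold>\<rightarrow> (y \<otimes> z)"
    using assms residuation[of y z "y \<otimes> z"] le_refl by (simp add: cl)
  then have "x \<^bold>\<le> z \<^bold>\<rightarrow> (y \<otimes> z)"
    using assms le_trans by (meson cl)
  then show ?thesis
    using assms residuation by (simp add: cl)
qed

lemma mult_mono_right:
  assumes "x \<^bold>\<le> y" "x \<in> carrier L" "y \<in> carrier L" "z \<in> carrier L"
  shows "z \<otimes> x \<^bold>\<le> z \<otimes> y"
  using mult_mono_left[OF assms] assms by (simp add: m_comm)

lemma mult_le_right: "\<lbrakk>x \<in> carrier L; y \<in> carrier L\<rbrakk> \<Longrightarrow> x \<otimes> y \<^bold>\<le> y"
  using mult_mono_left[of x \<one> y] le_one[of x] by simp

lemma mult_le_left: "\<lbrakk>x \<in> carrier L; y \<in> carrier L\<rbrakk> \<Longrightarrow> x \<otimes> y \<^bold>\<le> x"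
  by (metis mult_le_right m_comm)

lemma imp_mp: "\<lbrakk>x \<in> carrier L; y \<in> carrier L\<rbrakk> \<Longrightarrow> (x \<^bold>\<rightarrow> y) \<otimes> x \<^bold>\<le> y"
  using residuation[of "x \<^bold>\<rightarrow> y" x y] le_refl by (simp add: cl)

lemma mult_join_le:
  assumes "f \<otimes> x \<^bold>\<le> z" "f \<otimes> y \<^bold>\<le> z"
    and "f \<in> carrier L" "x \<in> carrier L" "y \<in> carrier L" "z \<in> carrier L"
  shows "f \<otimes> (x \<^bold>\<or> y) \<^bold>\<le> z"
proof -
  have "x \<^bold>\<le> f \<^bold>\<rightarrow> z" "y \<^bold>\<le> f \<^bold>\<rightarrow> z"
    using assms residuation m_comm by metis+
  then have "x \<^bold>\<or> y \<^bold>\<le> f \<^bold>\<rightarrow> z"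
    using assms by (simp add: join_least cl)
  then show ?thesis
    using assms residuation m_comm by (metis join_closed)
qed

end

locale filtered_rl = residuated_lattice +
  fixes F
  assumes filter: "rl_filter L F"
begin

lemma F_sub: "x \<in> F \<Longrightarrow> x \<in> carrier L"
  using filter unfolding rl_filter_def by blast

lemma F_mult: "\<lbrakk>x \<in> F; y \<in> F\<rbrakk> \<Longrightarrow> x \<otimes> y \<in> F"
  using filter unfolding rl_filter_def by blast

lemma F_up: "\<lbrakk>x \<in> F; x \<^bold>\<le> y; y \<in> carrier L\<rbrakk> \<Longrightarrow> y \<in> F"
  using filter unfolding rl_filter_def rl_le_def by metis

lemma F_one: "\<one> \<in> F"
  using filter F_up le_one one_closed F_sub unfolding rl_filter_def by blast

definition le_mod (infix "\<lesssim>" 50)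
  where "x \<lesssim> y \<longleftrightarrow> (\<exists>f\<in>F. f \<otimes> x \<^bold>\<le> y)"

lemma imp_in_iff: "\<lbrakk>x \<in> carrier L; y \<in> carrier L\<rbrakk> \<Longrightarrow> x \<^bold>\<rightarrow> y \<in> F \<longleftrightarrow> x \<lesssim> y"
  unfolding le_mod_def by (meson residuation F_up F_sub imp_closed imp_mp)

lemma le_mod_le: "\<lbrakk>x \<^bold>\<le> y; x \<in> carrier L; y \<in> carrier L\<rbrakk> \<Longrightarrow> x \<lesssim> y"
  unfolding le_mod_def by (rule bexI[OF _ F_one]) simp

lemma le_mod_trans:
  assumes "x \<lesssim> y" "y \<lesssim> z" and c: "x \<in> carrier L" "y \<in> carrier L" "z \<in> carrier L"
  shows "x \<lesssim> z"
proof -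
  obtain f g where f: "f \<in> F" "f \<otimes> x \<^bold>\<le> y" and g: "g \<in> F" "g \<otimes> y \<^bold>\<le> z"
    using assms unfolding le_mod_def by blast
  note c = c F_sub[OF f(1)] F_sub[OF g(1)]
  have "g \<otimes> (f \<otimes> x) \<^bold>\<le> g \<otimes> y"
    using c f by (simp add: mult_mono_right)
  then have "g \<otimes> (f \<otimes> x) \<^bold>\<le> z"
    by (rule le_trans) (use c g in \<open>simp_all\<close>)
  then show ?thesis
    unfolding le_mod_def using c f g F_mult[of g f]
    by (intro bexI[of _ "g \<otimes> f"]) (simp_all add: m_assoc)
qed

lemma le_mod_residuation:
  assumes c: "x \<in> carrier L" "y \<in> carrier L" "z \<in> carrier L"
  shows "x \<otimes> y \<lesssim> z \<longleftrightarrow> x \<lesssim> y \<^bold>\<rightarrow> z"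
proof -
  have "f \<otimes> (x \<otimes> y) \<^bold>\<le> z \<longleftrightarrow> f \<otimes> x \<^bold>\<le> y \<^bold>\<rightarrow> z" if "f \<in> F" for f
    using residuation[of "f \<otimes> x" y z] c F_sub[OF that] by (simp add: m_assoc)
  then show ?thesis
    unfolding le_mod_def by blast
qed

lemma le_mod_join:
  assumes "x \<lesssim> z" "y \<lesssim> z" and c: "x \<in> carrier L" "y \<in> carrier L" "z \<in> carrier L"
  shows "x \<^bold>\<or> y \<lesssim> z"
proof -
  obtain f g where f: "f \<in> F" "f \<otimes> x \<^bold>\<le> z" and g: "g \<in> F" "g \<otimes> y \<^bold>\<le> z"
    using assms unfolding le_mod_def by blast
  note c = c F_sub[OF f(1)] F_sub[OF g(1)]
  have "(f \<otimes> g) \<otimes> x \<^bold>\<le> f \<otimes> x" "(f \<otimes> g) \<otimes> y \<^bold>\<le> g \<otimes> y"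
    using c by (simp_all add: mult_mono_left mult_le_left mult_le_right)
  then have "(f \<otimes> g) \<otimes> x \<^bold>\<le> z" "(f \<otimes> g) \<otimes> y \<^bold>\<le> z"
    using le_trans f(2) g(2) c by (meson cl)+
  then have "(f \<otimes> g) \<otimes> (x \<^bold>\<or> y) \<^bold>\<le> z"
    using c by (simp add: mult_join_le)
  then show ?thesis
    unfolding le_mod_def using F_mult f g by blast
qed

lemma le_mod_meet:
  assumes "z \<lesssim> x" "z \<lesssim> y" and c: "x \<in> carrier L" "y \<in> carrier L" "z \<in> carrier L"
  shows "z \<lesssim> x \<^bold>\<and> y"
proof -
  obtain f g where f: "f \<in> F" "f \<otimes> z \<^bold>\<le> x" and g: "g \<in> F" "g \<otimes> z \<^bold>\<le> y"
    using assms unfolding le_mod_def by blast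
  note c = c F_sub[OF f(1)] F_sub[OF g(1)]
  have "(f \<otimes> g) \<otimes> z \<^bold>\<le> f \<otimes> z" "(f \<otimes> g) \<otimes> z \<^bold>\<le> g \<otimes> z"
    using c by (simp_all add: mult_mono_left mult_le_left mult_le_right)
  then have "(f \<otimes> g) \<otimes> z \<^bold>\<le> x" "(f \<otimes> g) \<otimes> z \<^bold>\<le> y"
    using le_trans f(2) g(2) c by (meson cl)+
  then have "(f \<otimes> g) \<otimes> z \<^bold>\<le> x \<^bold>\<and> y"
    using c by (simp add: meet_greatest)
  then show ?thesis
    unfolding le_mod_def using F_mult f g by blast
qed

lemma le_mod_mult_left:
  assumes "x \<lesssim> y" and c: "x \<in> carrier L" "y \<in> carrier L" "z \<in> carrier L"
  shows "x \<otimes> z \<lesssim> y \<otimes> z"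
proof -
  have "y \<lesssim> z \<^bold>\<rightarrow> (y \<otimes> z)"
    using c le_mod_residuation[of y z "y \<otimes> z"] by (simp add: le_mod_le le_refl)
  then have "x \<lesssim> z \<^bold>\<rightarrow> (y \<otimes> z)"
    using assms le_mod_trans by (meson cl)
  then show ?thesis
    using c by (simp add: le_mod_residuation)
qed

abbreviation cls where "cls x \<equiv> rl_cong L F `` {x}"

abbreviation Q where "Q \<equiv> L \<^bold>/\<^bold>/ F"

lemma cong_iff:
  "(x, y) \<in> rl_cong L F \<longleftrightarrow> x \<in> carrier L \<and> y \<in> carrier L \<and> x \<lesssim> y \<and> y \<lesssim> x"
  unfolding rl_cong_def using imp_in_iff by auto

lemma equiv_cong: "equiv (carrier L) (rl_cong L F)"
proof (rule equivI)
  show "rl_cong L F \<subseteq> carrier L \<times> carrier L"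
    unfolding rl_cong_def by auto
  show "refl_on (carrier L) (rl_cong L F)"
    unfolding refl_on_def by (auto simp: cong_iff le_mod_le le_refl)
  show "sym (rl_cong L F)"
    unfolding sym_def by (auto simp: cong_iff)
  show "trans (rl_cong L F)"
    unfolding trans_def by (meson cong_iff le_mod_trans)
qed

lemma cls_eq_iff:
  "\<lbrakk>x \<in> carrier L; y \<in> carrier L\<rbrakk> \<Longrightarrow> cls x = cls y \<longleftrightarrow> x \<lesssim> y \<and> y \<lesssim> x"
  using eq_equiv_class_iff[OF equiv_cong] cong_iff by auto

lemma Q_cases:
  assumes "X \<in> carrier Q" obtains x where "x \<in> carrier L" "X = cls x"
  using assms unfolding rl_quot_def quotient_def by auto

lemma cong_join:
  assumes "(x, x') \<in> rl_cong L F" "(y, y') \<in> rl_cong L F"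
  shows "(x \<^bold>\<or> y, x' \<^bold>\<or> y') \<in> rl_cong L F"
proof -
  have "u \<^bold>\<or> v \<lesssim> u' \<^bold>\<or> v'" if "u \<lesssim> u'" "v \<lesssim> v'"
    and "u \<in> carrier L" "u' \<in> carrier L" "v \<in> carrier L" "v' \<in> carrier L" for u u' v v'
    using that by (meson le_mod_join le_mod_trans le_mod_le le_join1 le_join2 join_closed)
  then show ?thesis
    using assms by (auto simp: cong_iff join_closed)
qed

lemma cong_meet:
  assumes "(x, x') \<in> rl_cong L F" "(y, y') \<in> rl_cong L F"
  shows "(x \<^bold>\<and> y, x' \<^bold>\<and> y') \<in> rl_cong L F"
proof -
  have "u \<^bold>\<and> v \<lesssim> u' \<^bold>\<and> v'" if "u \<lesssim> u'" "v \<lesssim> v'"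
    and "u \<in> carrier L" "u' \<in> carrier L" "v \<in> carrier L" "v' \<in> carrier L" for u u' v v'
    using that by (meson le_mod_meet le_mod_trans le_mod_le meet_le1 meet_le2 meet_closed)
  then show ?thesis
    using assms by (auto simp: cong_iff meet_closed)
qed

lemma cong_mult:
  assumes "(x, x') \<in> rl_cong L F" "(y, y') \<in> rl_cong L F"
  shows "(x \<otimes> y, x' \<otimes> y') \<in> rl_cong L F"
proof -
  have "u \<otimes> v \<lesssim> u' \<otimes> v'" if "u \<lesssim> u'" "v \<lesssim> v'"
    and c: "u \<in> carrier L" "u' \<in> carrier L" "v \<in> carrier L" "v' \<in> carrier L" for u u' v v'
  proof -
    have "u \<otimes> v \<lesssim> u' \<otimes> v" "u' \<otimes> v \<lesssim> u' \<otimes> v'"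
      using that le_mod_mult_left[of u u' v] le_mod_mult_left[of v v' u'] by (simp_all add: m_comm)
    then show ?thesis
      using c by (meson le_mod_trans m_closed)
  qed
  then show ?thesis
    using assms by (auto simp: cong_iff)
qed

lemma cong_imp:
  assumes "(x, x') \<in> rl_cong L F" "(y, y') \<in> rl_cong L F"
  shows "(x \<^bold>\<rightarrow> y, x' \<^bold>\<rightarrow> y') \<in> rl_cong L F"
proof -
  have "u \<^bold>\<rightarrow> v \<lesssim> u' \<^bold>\<rightarrow> v'" if "u' \<lesssim> u" "v \<lesssim> v'"
    and c: "u \<in> carrier L" "u' \<in> carrier L" "v \<in> carrier L" "v' \<in> carrier L" for u u' v v'
  proof -
    have "(u \<^bold>\<rightarrow> v) \<otimes> u' \<lesssim> (u \<^bold>\<rightarrow> v) \<otimes> u"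
      using that le_mod_mult_left[of u' u "u \<^bold>\<rightarrow> v"] by (simp add: m_comm imp_closed)
    moreover have "(u \<^bold>\<rightarrow> v) \<otimes> u \<lesssim> v"
      using c by (simp add: le_mod_le imp_mp imp_closed)
    ultimately have "(u \<^bold>\<rightarrow> v) \<otimes> u' \<lesssim> v'"
      using that by (meson le_mod_trans m_closed imp_closed)
    then show ?thesis
      using c by (simp add: le_mod_residuation imp_closed)
  qed
  then show ?thesis
    using assms by (auto simp: cong_iff imp_closed)
qed

lemma lift_op_class:
  assumes "\<And>x x' y y'. \<lbrakk>(x, x') \<in> rl_cong L F; (y, y') \<in> rl_cong L F\<rbrakk>
      \<Longrightarrow> (f x y, f x' y') \<in> rl_cong L F"
    and "x \<in> carrier L" "y \<in> carrier L"
  shows "lift_op L F f (cls x) (cls y) = cls (f x y)"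
proof -
  have "congruent2 (rl_cong L F) (rl_cong L F) (\<lambda>x y. cls (f x y))"
    unfolding congruent2_def using assms(1) equiv_class_eq[OF equiv_cong] by blast
  then show ?thesis
    unfolding lift_op_def by (rule UN_equiv_class2[OF equiv_cong equiv_cong _ assms(2,3)])
qed

lemma Q_carrier: "x \<in> carrier L \<Longrightarrow> cls x \<in> carrier Q"
  unfolding rl_quot_def by (simp add: quotientI)

lemma Q_ops:
  "\<one>\<^bsub>Q\<^esub> = cls \<one>"
  "\<^bold>0\<^bsub>Q\<^esub> = cls \<^bold>0"
  "\<lbrakk>x \<in> carrier L; y \<in> carrier L\<rbrakk> \<Longrightarrow> cls x \<otimes>\<^bsub>Q\<^esub> cls y = cls (x \<otimes> y)"
  "\<lbrakk>x \<in> carrier L; y \<in> carrier L\<rbrakk> \<Longrightarrow> cls x \<^bold>\<or>\<^bsub>Q\<^esub> cls y = cls (x \<^bold>\<or> y)"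
  "\<lbrakk>x \<in> carrier L; y \<in> carrier L\<rbrakk> \<Longrightarrow> cls x \<^bold>\<and>\<^bsub>Q\<^esub> cls y = cls (x \<^bold>\<and> y)"
  "\<lbrakk>x \<in> carrier L; y \<in> carrier L\<rbrakk> \<Longrightarrow> cls x \<^bold>\<rightarrow>\<^bsub>Q\<^esub> cls y = cls (x \<^bold>\<rightarrow> y)"
  unfolding rl_quot_def
  by (simp_all add: lift_op_class cong_mult cong_join cong_meet cong_imp)

lemma Q_le:
  assumes c: "x \<in> carrier L" "y \<in> carrier L"
  shows "cls x \<^bold>\<le>\<^bsub>Q\<^esub> cls y \<longleftrightarrow> x \<lesssim> y"
proof -
  have "x \<^bold>\<or> y \<lesssim> y \<longleftrightarrow> x \<lesssim> y" and "y \<lesssim> x \<^bold>\<or> y"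
    using c by (meson le_mod_join le_mod_trans le_mod_le le_join1 le_join2 join_closed le_refl)+
  then show ?thesis
    using c by (simp add: rl_le_def Q_ops cls_eq_iff join_closed)
qed

lemma quotient_residuated_lattice: "residuated_lattice Q"
proof (unfold_locales, goal_cases)
  case (1 x y)
  then show ?case by (auto elim!: Q_cases simp: Q_ops intro!: Q_carrier)
next
  case (2 x y z)
  then show ?case by (auto elim!: Q_cases simp: Q_ops m_assoc)
next
  case 3
  then show ?case by (auto simp: Q_ops intro!: Q_carrier)
next
  case (4 x)
  then show ?case by (auto elim!: Q_cases simp: Q_ops)
next
  case (5 x)
  then show ?case by (auto elim!: Q_cases simp: Q_ops)
next
  case (6 x y)
  then show ?case by (auto elim!: Q_cases simp: Q_ops m_comm)
qed (auto elim!: Q_cases intro!: Q_carrier le_mod_le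
    simp: Q_ops Q_le cl join_assoc meet_assoc join_meet_absorb meet_join_absorb
      zero_le le_one le_mod_residuation,
    (metis join_comm meet_comm)+)

end

end

theory Submission
  imports Defs
begin

text \<open>
  All the conditions are ways of saying that \<open>D(m) \<subseteq> n\<close> forces \<open>n = m\<close> for maximal filters
  \<open>m\<close>, \<open>n\<close>; call this the separation condition.

  That separation is the Gelfand property rests on one fact about primes: \<open>D(p) \<subseteq> q\<close> holds iff some
  prime filter lies below both \<open>p\<close> and \<open>q\<close> (\<open>D_filter_subset_iff_common_prime\<close>).  Indeed
  \<open>D(p) \<subseteq> q\<close> says that no \<open>a \<notin> q\<close> and \<open>x \<notin> p\<close> have join \<open>1\<close>.  The joins of such elements
  then form a join-closed set that avoids the filter \<open>{1}\<close>, and a prime filter avoiding this set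
  lies below both \<open>p\<close> and \<open>q\<close>.  So separation says that distinct maximal filters never lie
  above the same prime, while every prime lies below some maximal filter by Zorn's lemma.

  Several of the conditions restate separation or its consequence for proper filters and primes.  The
  others are translated into it by two dictionaries.  The first concerns joins of filters:
  \<open>F\<close> and \<open>G\<close> generate everything iff no maximal filter contains both
  (\<open>filter_join_whole_iff_no_common_maximal\<close>), and also iff \<open>f \<otimes> g = 0\<close> for some \<open>f \<in> F\<close>,
  \<open>g \<in> G\<close> (\<open>filter_join_whole_iff_zero\<close>).  The two together turn statements about maximal filters
  into statements about elements: with \<open>F = D(m)\<close> and \<open>G = D(n)\<close> they give the complement
  condition, with \<open>G\<close> the filter generated by one element \<open>x\<close> the condition on \<open>\<not> x\<^sup>n\<close>.
  The second is the correspondence between the maximal filters of a quotient by \<open>F\<close> and the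
  maximal filters that contain \<open>F\<close> (\<open>local_quotient_iff\<close>), which makes the quotient by \<open>D(m)\<close>
  local exactly when \<open>m\<close> is the only maximal filter above \<open>D(m)\<close>.
\<close>

section \<open>Filters and residuation\<close>

context residuated_lattice
begin

lemma filtered: "rl_filter L F \<Longrightarrow> filtered_rl L F"
  by (simp add: filtered_rl.intro filtered_rl_axioms.intro residuated_lattice_axioms)

lemmas filter_sub = filtered_rl.F_sub[OF filtered]
lemmas filter_mult = filtered_rl.F_mult[OF filtered]
lemmas filter_up = filtered_rl.F_up[OF filtered]
lemmas filter_one = filtered_rl.F_one[OF filtered]

lemma filterI:
  assumes "F \<subseteq> carrier L" "\<one> \<in> F"
    and "\<And>x y. \<lbrakk>x \<in> F; y \<in> F\<rbrakk> \<Longrightarrow> x \<otimes> y \<in> F"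
    and "\<And>x y. \<lbrakk>x \<in> F; x \<^bold>\<le> y; y \<in> carrier L\<rbrakk> \<Longrightarrow> y \<in> F"
  shows "rl_filter L F"
proof -
  have "x \<^bold>\<or> y \<in> F" if "x \<in> F" "y \<in> carrier L" for x y
    using assms(1) that by (intro assms(4)[OF that(1)] le_join1 join_closed) auto
  then show ?thesis
    unfolding rl_filter_def using assms(1-3) by auto
qed

lemma proper_iff_zero_notin: "proper_filter L F \<longleftrightarrow> rl_filter L F \<and> \<^bold>0 \<notin> F"
proof -
  have "F = carrier L" if that: "rl_filter L F" "\<^bold>0 \<in> F"
  proof
    show "F \<subseteq> carrier L"
      using filter_sub[OF that(1)] by blast
    show "carrier L \<subseteq> F"
      using filter_up[OF that zero_le] by blast
  qed
  then show ?thesis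
    unfolding proper_filter_def using zero_closed by blast
qed

lemma maximal_is_proper: "maximal_filter L m \<Longrightarrow> proper_filter L m"
  by (simp add: maximal_filter_def)

lemma maximal_is_filter: "maximal_filter L m \<Longrightarrow> rl_filter L m"
  by (simp add: maximal_filter_def proper_filter_def)

lemma maximal_eq: "\<lbrakk>maximal_filter L m; proper_filter L F; m \<subseteq> F\<rbrakk> \<Longrightarrow> F = m"
  by (simp add: maximal_filter_def)

lemma prime_is_filter: "prime_filter L p \<Longrightarrow> rl_filter L p"
  by (simp add: prime_filter_def proper_filter_def)

lemma prime_join_notin:
  "\<lbrakk>prime_filter L p; x \<in> carrier L - p; y \<in> carrier L - p\<rbrakk> \<Longrightarrow> x \<^bold>\<or> y \<in> carrier L - p"
  unfolding prime_filter_def using join_closed by blast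

lemma mult_neg: "x \<in> carrier L \<Longrightarrow> x \<otimes> \<^bold>\<not> x = \<^bold>0"
  unfolding rl_neg_def by (metis imp_mp imp_closed zero_closed m_comm m_closed le_antisym zero_le)

lemma neg_closed: "x \<in> carrier L \<Longrightarrow> \<^bold>\<not> x \<in> carrier L"
  unfolding rl_neg_def by (simp add: imp_closed zero_closed)

lemma le_neg_iff: "\<lbrakk>x \<in> carrier L; y \<in> carrier L\<rbrakk> \<Longrightarrow> x \<^bold>\<le> \<^bold>\<not> y \<longleftrightarrow> x \<otimes> y = \<^bold>0"
  unfolding rl_neg_def
  by (metis residuation zero_closed m_closed zero_le le_antisym le_refl)

text \<open>
  Of the four products obtained by distributing, all but \<open>x \<otimes> y\<close> lie below \<open>u\<close> or \<open>v\<close>.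
  Because of this inequality, sets defined by a join condition are closed under products.
\<close>

lemma join_mult_join_le:
  assumes c: "x \<in> carrier L" "y \<in> carrier L" "u \<in> carrier L" "v \<in> carrier L"
  shows "(x \<^bold>\<or> u) \<otimes> (y \<^bold>\<or> v) \<^bold>\<le> (x \<otimes> y) \<^bold>\<or> (u \<^bold>\<or> v)"
proof -
  let ?z = "(x \<otimes> y) \<^bold>\<or> (u \<^bold>\<or> v)"
  have z: "?z \<in> carrier L" and uv: "u \<^bold>\<or> v \<^bold>\<le> ?z"
    using c by (simp_all add: cl le_join2)
  have u: "u \<^bold>\<le> ?z" and v: "v \<^bold>\<le> ?z"
    using le_trans[OF le_join1[of u v] uv] le_trans[OF le_join2[of u v] uv] c z
    by (simp_all add: cl)
  have "x \<otimes> y \<^bold>\<le> ?z"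
    using c by (simp add: cl le_join1)
  moreover have "x \<otimes> v \<^bold>\<le> ?z"
    using le_trans[OF mult_le_right[of x v] v] c z by simp
  ultimately have "x \<otimes> (y \<^bold>\<or> v) \<^bold>\<le> ?z"
    using c z by (simp add: mult_join_le)
  moreover have "u \<otimes> (y \<^bold>\<or> v) \<^bold>\<le> ?z"
    using le_trans[OF mult_le_left[of u "y \<^bold>\<or> v"] u] c z by (simp add: cl)
  ultimately show ?thesis
    using mult_join_le[of "y \<^bold>\<or> v" x ?z u] c z m_comm by (simp add: cl)
qed

section \<open>Prime filters that avoid a join-closed set\<close>

text \<open>
  Colon filters do the work of the filter generated by \<open>F\<close> and an element: if \<open>x \<^bold>\<or> y \<in> F\<close>, then
  the colon filter at \<open>y\<close> extends \<open>F\<close> and contains \<open>x\<close>, and no powers have to be handled.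
\<close>

lemma colon_filter:
  assumes F: "rl_filter L F" and y: "y \<in> carrier L"
  shows "rl_filter L {z \<in> carrier L. z \<^bold>\<or> y \<in> F}" (is "rl_filter L ?C")
proof (rule filterI)
  show "?C \<subseteq> carrier L" by blast
  show "\<one> \<in> ?C"
    using le_join1[of \<one> y] filter_up[OF F filter_one[OF F]] y by (simp add: cl)
next
  fix u v assume uv: "u \<in> ?C" "v \<in> ?C"
  then have "(u \<^bold>\<or> y) \<otimes> (v \<^bold>\<or> y) \<in> F"
    using filter_mult[OF F] by blast
  moreover have "(u \<^bold>\<or> y) \<otimes> (v \<^bold>\<or> y) \<^bold>\<le> (u \<otimes> v) \<^bold>\<or> y"
    using join_mult_join_le[of u v y y] uv y le_refl[OF y] by (simp add: rl_le_def)
  ultimately show "u \<otimes> v \<in> ?C"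
    using filter_up[OF F] uv y by (simp add: cl)
next
  fix u v assume u: "u \<in> ?C" and v: "u \<^bold>\<le> v" "v \<in> carrier L"
  have "u \<^bold>\<or> y \<^bold>\<le> v \<^bold>\<or> y"
    using u v y by (auto intro!: join_least le_join2 le_trans[OF v(1) le_join1] simp: cl)
  then have "v \<^bold>\<or> y \<in> F"
    using filter_up[OF F, of "u \<^bold>\<or> y"] u v y by (simp add: cl)
  then show "v \<in> ?C"
    using v by simp
qed

text \<open>
  A filter that is maximal among those avoiding \<open>S\<close> is prime.  Suppose \<open>x \<^bold>\<or> y \<in> P\<close> with \<open>x\<close> and
  \<open>y\<close> outside \<open>P\<close>.  The colon filter at \<open>y\<close> is too large to avoid \<open>S\<close>, so \<open>s \<^bold>\<or> y \<in> P\<close> for some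
  \<open>s \<in> S\<close>; the same argument at \<open>s\<close> gives \<open>t \<^bold>\<or> s \<in> P\<close> for some \<open>t \<in> S\<close>, and \<open>t \<^bold>\<or> s \<in> S\<close>.
  The maximality of \<open>P\<close> is kept in the conclusion because, for \<open>S = {0}\<close>, it makes \<open>P\<close> a maximal
  filter.
\<close>

lemma prime_filter_avoiding:
  assumes F: "rl_filter L F"
    and S: "S \<subseteq> carrier L" "S \<noteq> {}" "\<forall>s\<in>S. \<forall>t\<in>S. s \<^bold>\<or> t \<in> S"
    and disj: "F \<inter> S = {}"
  shows "\<exists>P. prime_filter L P \<and> F \<subseteq> P \<and> P \<inter> S = {}
    \<and> (\<forall>G. rl_filter L G \<and> P \<subseteq> G \<and> G \<inter> S = {} \<longrightarrow> G = P)"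
proof -
  let ?\<A> = "{G. rl_filter L G \<and> F \<subseteq> G \<and> G \<inter> S = {}}"
  have "\<exists>P\<in>?\<A>. \<forall>G\<in>?\<A>. P \<subseteq> G \<longrightarrow> G = P"
  proof (rule subset_Zorn_nonempty)
    show "?\<A> \<noteq> {}"
      using F disj by blast
  next
    fix C assume "C \<noteq> {}" and C: "subset.chain ?\<A> C"
    have fil: "rl_filter L G" if "G \<in> C" for G
      using C that unfolding subset.chain_def by blast
    have "rl_filter L (\<Union>C)"
    proof (rule filterI)
      show "\<Union>C \<subseteq> carrier L"
        using fil filter_sub by blast
      show "\<one> \<in> \<Union>C"
        using \<open>C \<noteq> {}\<close> fil filter_one by blast
    next
      fix x y assume "x \<in> \<Union>C" "y \<in> \<Union>C"
      then obtain G H where GH: "x \<in> G" "G \<in> C" "y \<in> H" "H \<in> C" by blast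
      have "G \<subseteq> H \<or> H \<subseteq> G"
        using C GH unfolding subset_chain_def by blast
      then show "x \<otimes> y \<in> \<Union>C"
        using GH fil filter_mult by (metis UnionI subsetD)
    next
      fix x y assume "x \<in> \<Union>C" "x \<^bold>\<le> y" "y \<in> carrier L"
      then show "y \<in> \<Union>C"
        using fil filter_up by blast
    qed
    then show "\<Union>C \<in> ?\<A>"
      using C \<open>C \<noteq> {}\<close> unfolding subset.chain_def by blast
  qed
  then obtain P where "P \<in> ?\<A>" and max_\<A>: "\<forall>G\<in>?\<A>. P \<subseteq> G \<longrightarrow> G = P"
    by (rule bexE)
  then have P: "rl_filter L P" "F \<subseteq> P" "P \<inter> S = {}"
    by auto
  have max: "G = P" if "rl_filter L G" "P \<subseteq> G" "G \<inter> S = {}" for G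
    using max_\<A> that order_trans[OF P(2) that(2)] by auto
  \<comment> \<open>The colon filter of \<open>P\<close> at \<open>y\<close> contains \<open>x\<close>, so by maximality of \<open>P\<close> it meets \<open>S\<close>.\<close>
  have meets: "\<exists>s\<in>S. s \<^bold>\<or> y \<in> P"
    if "x \<in> carrier L" "y \<in> carrier L" "x \<^bold>\<or> y \<in> P" "x \<notin> P" for x y
  proof -
    let ?C = "{z \<in> carrier L. z \<^bold>\<or> y \<in> P}"
    have "P \<subseteq> ?C"
      using filter_sub[OF P(1)] filter_up[OF P(1) _ le_join1] that by (auto simp: cl)
    then show ?thesis
      using max[OF colon_filter[OF P(1)], of y] that by blast
  qed
  have "x \<in> P \<or> y \<in> P" if c: "x \<in> carrier L" "y \<in> carrier L" and xy: "x \<^bold>\<or> y \<in> P" for x y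
  proof (rule ccontr)
    assume notin: "\<not> (x \<in> P \<or> y \<in> P)"
    then obtain s where s: "s \<in> S" "s \<^bold>\<or> y \<in> P"
      using meets c xy by blast
    then have "y \<^bold>\<or> s \<in> P"
      using S c join_comm by (metis subsetD)
    then obtain t where "t \<in> S" "t \<^bold>\<or> s \<in> P"
      using meets[of y s] S s c notin by blast
    then show False
      using S(3) s P(3) by blast
  qed
  moreover have "proper_filter L P"
    unfolding proper_filter_def using P S(1,2) by blast
  ultimately have "prime_filter L P"
    by (simp add: prime_filter_def)
  then show ?thesis
    using P(2,3) max by (intro exI[of _ P]) simp
qed

lemma maximal_and_prime_above:
  assumes "proper_filter L F"
  obtains m where "maximal_filter L m" "prime_filter L m" "F \<subseteq> m"
proof -
  have F: "rl_filter L F" "F \<inter> {\<^bold>0} = {}"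
    using assms by (auto simp: proper_iff_zero_notin)
  have z: "{\<^bold>0} \<subseteq> carrier L" "{\<^bold>0} \<noteq> {}"
    "\<forall>s\<in>{\<^bold>0}. \<forall>t\<in>{\<^bold>0}. s \<^bold>\<or> t \<in> {\<^bold>0}"
    using zero_closed zero_le[OF zero_closed] by (auto simp: rl_le_def)
  obtain m where m: "prime_filter L m" "F \<subseteq> m"
    and max: "\<forall>G. rl_filter L G \<and> m \<subseteq> G \<and> G \<inter> {\<^bold>0} = {} \<longrightarrow> G = m"
    using prime_filter_avoiding[OF F(1) z F(2)] by (elim exE conjE)
  have "maximal_filter L m"
    unfolding maximal_filter_def
    using m(1) max by (auto simp: proper_iff_zero_notin prime_filter_def)
  then show ?thesis
    using that m by blast
qed

lemma maximal_above:
  assumes "proper_filter L F" obtains m where "maximal_filter L m" "F \<subseteq> m"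
  using maximal_and_prime_above[OF assms] by blast

lemma maximal_is_prime: "maximal_filter L m \<Longrightarrow> prime_filter L m"
  by (metis maximal_and_prime_above maximal_is_proper maximal_eq)

lemma maximal_subset_eq:
  "\<lbrakk>maximal_filter L m; maximal_filter L n; m \<subseteq> n\<rbrakk> \<Longrightarrow> n = m"
  using maximal_eq maximal_is_proper by blast

section \<open>The filter D(p)\<close>

lemma one_filter: "rl_filter L {\<one>}"
  by (rule filterI) (auto intro: le_antisym le_one)

lemma D_filter_subset_iff:
  "q \<subseteq> carrier L \<Longrightarrow> D_filter L p \<subseteq> q \<longleftrightarrow>
    \<not> (\<exists>a \<in> carrier L - q. \<exists>x \<in> carrier L - p. a \<^bold>\<or> x = \<one>)"
  unfolding D_filter_def by blast

text \<open>
  \<open>D(p)\<close> is the union of the colon filters of \<open>{1}\<close> at the elements outside \<open>p\<close>, and this union is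
  directed because, \<open>p\<close> being prime, the complement of \<open>p\<close> is closed under joins.
\<close>

lemma D_filter_is_filter:
  assumes p: "prime_filter L p"
  shows "rl_filter L (D_filter L p)"
proof (rule filterI)
  have "\<one> \<^bold>\<or> \<^bold>0 = \<one>"
    using zero_le[of \<one>] join_comm[of \<one> "\<^bold>0"] by (simp add: rl_le_def cl)
  moreover have "\<^bold>0 \<in> carrier L - p"
    using p zero_closed by (simp add: prime_filter_def proper_iff_zero_notin)
  ultimately show "\<one> \<in> D_filter L p"
    unfolding D_filter_def by auto
next
  fix a b assume "a \<in> D_filter L p" "b \<in> D_filter L p"
  then obtain x y where *: "a \<in> carrier L" "b \<in> carrier L" "x \<in> carrier L - p" "y \<in> carrier L - p"
    "a \<^bold>\<or> x = \<one>" "b \<^bold>\<or> y = \<one>"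
    unfolding D_filter_def by blast
  have "\<one> \<^bold>\<le> (a \<otimes> b) \<^bold>\<or> (x \<^bold>\<or> y)"
    using join_mult_join_le[of a b x y] * by simp
  then have "(a \<otimes> b) \<^bold>\<or> (x \<^bold>\<or> y) = \<one>"
    using * by (intro le_antisym le_one) (auto simp: cl)
  then show "a \<otimes> b \<in> D_filter L p"
    unfolding D_filter_def using * prime_join_notin[OF p *(3,4)] by auto
next
  fix a b assume "a \<in> D_filter L p" and b: "a \<^bold>\<le> b" "b \<in> carrier L"
  then obtain x where *: "a \<in> carrier L" "x \<in> carrier L - p" "a \<^bold>\<or> x = \<one>"
    unfolding D_filter_def by blast
  have "b \<^bold>\<or> x = \<one>"
    using filter_up[OF colon_filter[OF one_filter, of x], of a b] * b by simp
  then show "b \<in> D_filter L p"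
    unfolding D_filter_def using * b by blast
qed (auto simp: D_filter_def)

lemma D_filter_subset_generization:
  assumes q: "prime_filter L q" and "q \<subseteq> p"
  shows "D_filter L p \<subseteq> q"
  using assms filter_one[OF prime_is_filter[OF q]]
  unfolding D_filter_def prime_filter_def by (smt (verit) DiffE mem_Collect_eq subset_iff)

text \<open>
  The set \<open>S\<close> of all joins \<open>a \<^bold>\<or> x\<close> with \<open>a \<notin> q\<close> and \<open>x \<notin> p\<close> misses \<open>1\<close> exactly when
  \<open>D(p) \<subseteq> q\<close>.  As \<open>0\<close> is outside \<open>p\<close> and \<open>q\<close>, the set \<open>S\<close> contains both complements, so a
  prime that avoids it lies below \<open>p\<close> and \<open>q\<close>.  Conversely, a prime below \<open>p\<close> contains \<open>D(p)\<close>.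
\<close>

lemma D_filter_subset_iff_common_prime:
  assumes p: "prime_filter L p" and q: "prime_filter L q"
  shows "D_filter L p \<subseteq> q \<longleftrightarrow> (\<exists>r. prime_filter L r \<and> r \<subseteq> p \<and> r \<subseteq> q)"
proof
  assume D: "D_filter L p \<subseteq> q"
  let ?S = "{a \<^bold>\<or> x |a x. a \<in> carrier L - q \<and> x \<in> carrier L - p}"
  have zero: "\<^bold>0 \<in> carrier L - q" "\<^bold>0 \<in> carrier L - p"
    using p q zero_closed by (simp_all add: prime_filter_def proper_iff_zero_notin)
  have in_S: "x \<in> ?S" if "x \<in> carrier L - q \<or> x \<in> carrier L - p" for x
  proof -
    have "x = x \<^bold>\<or> \<^bold>0" "x = \<^bold>0 \<^bold>\<or> x"
      using that zero_le[of x] join_comm[of x "\<^bold>0"] zero_closed by (auto simp: rl_le_def)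
    then show ?thesis
      using that zero by blast
  qed
  have "?S \<subseteq> carrier L"
    using join_closed by blast
  moreover have "?S \<noteq> {}"
    using in_S[of "\<^bold>0"] zero by blast
  moreover have "\<forall>s\<in>?S. \<forall>t\<in>?S. s \<^bold>\<or> t \<in> ?S"
  proof (intro ballI)
    fix s t assume "s \<in> ?S" "t \<in> ?S"
    then obtain a x b y where *: "s = a \<^bold>\<or> x" "t = b \<^bold>\<or> y" "a \<in> carrier L - q" "b \<in> carrier L - q"
      "x \<in> carrier L - p" "y \<in> carrier L - p"
      by blast
    have "s \<^bold>\<or> t = a \<^bold>\<or> (x \<^bold>\<or> (b \<^bold>\<or> y))"
      using * by (simp add: join_assoc cl)
    also have "x \<^bold>\<or> (b \<^bold>\<or> y) = (x \<^bold>\<or> b) \<^bold>\<or> y"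
      using * by (simp add: join_assoc)
    also have "x \<^bold>\<or> b = b \<^bold>\<or> x"
      using * by (simp add: join_comm)
    also have "a \<^bold>\<or> (b \<^bold>\<or> x \<^bold>\<or> y) = (a \<^bold>\<or> b) \<^bold>\<or> (x \<^bold>\<or> y)"
      using * by (simp add: join_assoc cl)
    finally show "s \<^bold>\<or> t \<in> ?S"
      using prime_join_notin[OF q *(3,4)] prime_join_notin[OF p *(5,6)] by blast
  qed
  moreover have "{\<one>} \<inter> ?S = {}"
    using D D_filter_subset_iff[of q p] filter_sub[OF prime_is_filter[OF q]] by fastforce
  ultimately obtain r where r: "prime_filter L r" "r \<inter> ?S = {}"
    using prime_filter_avoiding[OF one_filter, of ?S] by blast
  have "x \<in> p \<and> x \<in> q" if "x \<in> r" for x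
    using in_S[of x] r(2) that filter_sub[OF prime_is_filter[OF r(1)] that] by auto
  then show "\<exists>r. prime_filter L r \<and> r \<subseteq> p \<and> r \<subseteq> q"
    using r(1) by auto
next
  assume "\<exists>r. prime_filter L r \<and> r \<subseteq> p \<and> r \<subseteq> q"
  then show "D_filter L p \<subseteq> q"
    using D_filter_subset_generization by blast
qed

lemma D_filter_subset_self: "prime_filter L p \<Longrightarrow> D_filter L p \<subseteq> p"
  by (simp add: D_filter_subset_generization)

section \<open>The filter generated by two filters\<close>

lemma
  assumes F: "rl_filter L F" and G: "rl_filter L G"
  shows filter_join_eq: "F \<^bold>\<squnion> G = {z \<in> carrier L. \<exists>f\<in>F. \<exists>g\<in>G. f \<otimes> g \<^bold>\<le> z}" (is "_ = ?J")
    and filter_join_filter: "rl_filter L (F \<^bold>\<squnion> G)"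
proof -
  note sub = filter_sub[OF F] filter_sub[OF G]
  have "f \<in> ?J" if "f \<in> F" for f
  proof -
    have "f \<otimes> \<one> \<^bold>\<le> f"
      using sub(1)[OF that] le_refl by simp
    then show ?thesis
      using that sub(1)[OF that] filter_one[OF G] by blast
  qed
  moreover have "g \<in> ?J" if "g \<in> G" for g
  proof -
    have "\<one> \<otimes> g \<^bold>\<le> g"
      using sub(2)[OF that] le_refl by simp
    then show ?thesis
      using that sub(2)[OF that] filter_one[OF F] by blast
  qed
  ultimately have sub_J: "F \<union> G \<subseteq> ?J"
    by blast
  then have one: "\<one> \<in> ?J"
    using filter_one[OF F] by blast
  have fil_J: "rl_filter L ?J"
  proof (rule filterI)
    fix x y assume "x \<in> ?J" "y \<in> ?J"
    then obtain f g f' g' where *: "f \<in> F" "g \<in> G" "f' \<in> F" "g' \<in> G"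
      "f \<otimes> g \<^bold>\<le> x" "f' \<otimes> g' \<^bold>\<le> y" and xy: "x \<in> carrier L" "y \<in> carrier L"
      by blast
    note c = xy sub(1)[OF *(1)] sub(2)[OF *(2)] sub(1)[OF *(3)] sub(2)[OF *(4)]
    have "(f \<otimes> g) \<otimes> (f' \<otimes> g') \<^bold>\<le> x \<otimes> (f' \<otimes> g')" "x \<otimes> (f' \<otimes> g') \<^bold>\<le> x \<otimes> y"
      using * c by (simp_all add: mult_mono_left mult_mono_right)
    then have "(f \<otimes> g) \<otimes> (f' \<otimes> g') \<^bold>\<le> x \<otimes> y"
      using le_trans c by (meson m_closed)
    also have "(f \<otimes> g) \<otimes> (f' \<otimes> g') = (f \<otimes> f') \<otimes> (g \<otimes> g')"
      using c by (simp add: m_ac)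
    finally show "x \<otimes> y \<in> ?J"
      using filter_mult[OF F *(1,3)] filter_mult[OF G *(2,4)] xy by blast
  next
    fix x y assume "x \<in> ?J" and y: "x \<^bold>\<le> y" "y \<in> carrier L"
    then obtain f g where fg: "f \<in> F" "g \<in> G" "f \<otimes> g \<^bold>\<le> x" "x \<in> carrier L"
      by blast
    then have "f \<otimes> g \<^bold>\<le> y"
      using le_trans[OF fg(3) y(1)] sub(1)[OF fg(1)] sub(2)[OF fg(2)] y(2) by simp
    then show "y \<in> ?J"
      using fg y(2) by blast
  qed (use one in auto)
  have "?J \<subseteq> H" if that: "F \<union> G \<subseteq> H" and H: "rl_filter L H" for H
  proof
    fix z assume "z \<in> ?J"
    then obtain f g where fg: "f \<in> F" "g \<in> G" "f \<otimes> g \<^bold>\<le> z" "z \<in> carrier L"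
      by blast
    then have "f \<otimes> g \<in> H"
      using that(1) by (intro filter_mult[OF H]) auto
    then show "z \<in> H"
      using filter_up[OF H _ fg(3,4)] by simp
  qed
  then show eq: "F \<^bold>\<squnion> G = ?J"
    unfolding filter_join_def using sub_J fil_J by (intro hull_unique)
  show "rl_filter L (F \<^bold>\<squnion> G)"
    unfolding eq by (rule fil_J)
qed

lemma filter_join_upper: "F \<subseteq> F \<^bold>\<squnion> G" "G \<subseteq> F \<^bold>\<squnion> G"
  unfolding filter_join_def using hull_subset[of "F \<union> G" "rl_filter L"] by auto

lemma filter_join_least: "\<lbrakk>F \<subseteq> H; G \<subseteq> H; rl_filter L H\<rbrakk> \<Longrightarrow> F \<^bold>\<squnion> G \<subseteq> H"
  unfolding filter_join_def by (simp add: hull_minimal)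

lemma filter_join_whole_iff_zero:
  assumes F: "rl_filter L F" and G: "rl_filter L G"
  shows "F \<^bold>\<squnion> G = carrier L \<longleftrightarrow> (\<exists>f\<in>F. \<exists>g\<in>G. f \<otimes> g = \<^bold>0)"
proof -
  have "F \<^bold>\<squnion> G = carrier L \<longleftrightarrow> \<^bold>0 \<in> F \<^bold>\<squnion> G"
    using proper_iff_zero_notin filter_join_filter[OF F G] unfolding proper_filter_def by blast
  moreover have "f \<otimes> g \<^bold>\<le> \<^bold>0 \<longleftrightarrow> f \<otimes> g = \<^bold>0" if "f \<in> F" "g \<in> G" for f g
  proof -
    have "f \<otimes> g \<in> carrier L"
      using filter_sub[OF F that(1)] filter_sub[OF G that(2)] by simp
    then show ?thesis
      using zero_le zero_closed le_antisym[of "f \<otimes> g" "\<^bold>0"] le_refl by auto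
  qed
  ultimately show ?thesis
    unfolding filter_join_eq[OF F G] using zero_closed by blast
qed

text \<open>
  If the generated filter is proper, Zorn's lemma puts a maximal filter above it.
\<close>

lemma filter_join_whole_iff_no_common_maximal:
  assumes F: "rl_filter L F" and G: "rl_filter L G"
  shows "F \<^bold>\<squnion> G = carrier L \<longleftrightarrow> \<not> (\<exists>k. maximal_filter L k \<and> F \<subseteq> k \<and> G \<subseteq> k)"
proof
  assume whole: "F \<^bold>\<squnion> G = carrier L"
  show "\<not> (\<exists>k. maximal_filter L k \<and> F \<subseteq> k \<and> G \<subseteq> k)"
  proof
    assume "\<exists>k. maximal_filter L k \<and> F \<subseteq> k \<and> G \<subseteq> k"
    then obtain k where k: "maximal_filter L k" "F \<subseteq> k" "G \<subseteq> k"
      by blast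
    then have "carrier L \<subseteq> k"
      using filter_join_least[OF k(2,3) maximal_is_filter] whole by simp
    then show False
      using maximal_is_proper[OF k(1)] zero_closed by (auto simp: proper_iff_zero_notin)
  qed
next
  assume none: "\<not> (\<exists>k. maximal_filter L k \<and> F \<subseteq> k \<and> G \<subseteq> k)"
  show "F \<^bold>\<squnion> G = carrier L"
  proof (rule ccontr)
    assume "F \<^bold>\<squnion> G \<noteq> carrier L"
    then have "proper_filter L (F \<^bold>\<squnion> G)"
      by (simp add: proper_filter_def filter_join_filter[OF F G])
    then obtain k where "maximal_filter L k" "F \<^bold>\<squnion> G \<subseteq> k"
      by (rule maximal_above)
    then show False
      using none filter_join_upper by blast
  qed
qed

end

section \<open>Maximal filters of a quotient\<close>

lemma Ex1_iff_card: "(\<exists>!x. P x) \<longleftrightarrow> card {x. P x} = 1"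
  unfolding is_singleton_altdef[symmetric] is_singleton_def by (auto simp: set_eq_iff)

context filtered_rl
begin

definition pullback :: "'a set set \<Rightarrow> 'a set"
  where "pullback H = {x \<in> carrier L. cls x \<in> H}"

lemma image_pullback: "H \<subseteq> carrier Q \<Longrightarrow> cls ` pullback H = H"
  unfolding pullback_def by (auto elim!: Q_cases)

text \<open>
  A filter \<open>G\<close> above \<open>F\<close> is a union of congruence classes: for \<open>g \<in> G\<close>, every element \<open>x\<close> of the
  class of \<open>g\<close> satisfies \<open>f \<otimes> g \<^bold>\<le> x\<close> for some \<open>f \<in> F \<subseteq> G\<close>.
\<close>

lemma pullback_image:
  assumes G: "rl_filter L G" and "F \<subseteq> G"
  shows "pullback (cls ` G) = G"
proof -
  have "x \<in> G" if x: "x \<in> carrier L" "cls x = cls g" and g: "g \<in> G" for x g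
  proof -
    obtain f where "f \<in> F" "f \<otimes> g \<^bold>\<le> x"
      using x g filter_sub[OF G g] by (auto simp: cls_eq_iff le_mod_def)
    then show ?thesis
      using \<open>F \<subseteq> G\<close> filter_mult[OF G _ g] filter_up[OF G] x by blast
  qed
  then show ?thesis
    unfolding pullback_def using filter_sub[OF G] by auto
qed

lemma cls_F: "f \<in> F \<Longrightarrow> cls f = \<one>\<^bsub>Q\<^esub>"
  using F_sub[of f] le_one[of f] le_refl[of f]
  by (auto simp: Q_ops cls_eq_iff le_mod_le) (auto simp: le_mod_def intro!: bexI[of _ f])

lemma pullback_proper:
  assumes H: "proper_filter Q H"
  shows "proper_filter L (pullback H)" "F \<subseteq> pullback H"
proof -
  interpret Q: residuated_lattice Q
    by (rule quotient_residuated_lattice)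
  have fil: "rl_filter Q H" and zero: "\<^bold>0\<^bsub>Q\<^esub> \<notin> H"
    using H by (simp_all add: Q.proper_iff_zero_notin)
  have "rl_filter L (pullback H)"
  proof (rule filterI)
    show "\<one> \<in> pullback H"
      using Q.filter_one[OF fil] by (simp add: pullback_def Q_ops)
  next
    fix x y assume "x \<in> pullback H" "y \<in> pullback H"
    then show "x \<otimes> y \<in> pullback H"
      using Q.filter_mult[OF fil, of "cls x" "cls y"] by (simp add: pullback_def Q_ops)
  next
    fix x y assume "x \<in> pullback H" "x \<^bold>\<le> y" "y \<in> carrier L"
    then show "y \<in> pullback H"
      using Q.filter_up[OF fil, of "cls x" "cls y"]
      by (simp add: pullback_def Q_le le_mod_le Q_carrier)
  qed (auto simp: pullback_def)
  then show "proper_filter L (pullback H)"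
    using zero by (simp add: proper_iff_zero_notin pullback_def Q_ops)
  show "F \<subseteq> pullback H"
    using F_sub Q.filter_one[OF fil] by (auto simp: pullback_def cls_F)
qed

lemma image_proper:
  assumes G: "proper_filter L G" and "F \<subseteq> G"
  shows "proper_filter Q (cls ` G)"
proof -
  interpret Q: residuated_lattice Q
    by (rule quotient_residuated_lattice)
  have fil: "rl_filter L G" and zero: "\<^bold>0 \<notin> G"
    using G by (simp_all add: proper_iff_zero_notin)
  note sub = filter_sub[OF fil]
  have mem: "cls x \<in> cls ` G \<longleftrightarrow> x \<in> G" if "x \<in> carrier L" for x
    using pullback_image[OF fil \<open>F \<subseteq> G\<close>] that unfolding pullback_def by blast
  have "rl_filter Q (cls ` G)"
  proof (rule Q.filterI)
    show "cls ` G \<subseteq> carrier Q"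
      using sub Q_carrier by blast
    show "\<one>\<^bsub>Q\<^esub> \<in> cls ` G"
      using filter_one[OF fil] by (auto simp: Q_ops)
  next
    fix X Y assume "X \<in> cls ` G" "Y \<in> cls ` G"
    then obtain x y where "x \<in> G" "X = cls x" "y \<in> G" "Y = cls y"
      by blast
    then show "X \<otimes>\<^bsub>Q\<^esub> Y \<in> cls ` G"
      using filter_mult[OF fil, of x y] sub by (simp add: Q_ops)
  next
    fix X Y assume "X \<in> cls ` G" and le: "X \<^bold>\<le>\<^bsub>Q\<^esub> Y" and "Y \<in> carrier Q"
    then obtain x y where x: "x \<in> G" "X = cls x" and y: "y \<in> carrier L" "Y = cls y"
      using Q_cases by blast
    then obtain f where "f \<in> F" "f \<otimes> x \<^bold>\<le> y"
      using le sub by (auto simp: Q_le le_mod_def)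
    then have "y \<in> G"
      using \<open>F \<subseteq> G\<close> filter_mult[OF fil _ x(1)] filter_up[OF fil] y by blast
    then show "Y \<in> cls ` G"
      using y by blast
  qed
  moreover have "\<^bold>0\<^bsub>Q\<^esub> \<notin> cls ` G"
    using mem zero zero_closed by (simp add: Q_ops)
  ultimately show ?thesis
    by (simp add: Q.proper_iff_zero_notin)
qed

lemma image_maximal:
  assumes M: "maximal_filter L M" and "F \<subseteq> M"
  shows "maximal_filter Q (cls ` M)"
proof -
  have "K = cls ` M" if K: "proper_filter Q K" "cls ` M \<subseteq> K" for K
  proof -
    have "M \<subseteq> pullback K"
      using K(2) filter_sub[OF maximal_is_filter[OF M]] by (auto simp: pullback_def)
    then have "pullback K = M"
      using maximal_eq[OF M pullback_proper(1)[OF K(1)]] by simp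
    moreover have "K \<subseteq> carrier Q"
      using K(1) by (auto simp: proper_filter_def rl_filter_def)
    ultimately show ?thesis
      using image_pullback by blast
  qed
  then show ?thesis
    unfolding maximal_filter_def using image_proper[OF maximal_is_proper[OF M] \<open>F \<subseteq> M\<close>] by blast
qed

lemma pullback_maximal:
  assumes H: "maximal_filter Q H"
  shows "maximal_filter L (pullback H)"
proof -
  have proper: "proper_filter Q H" and sub: "H \<subseteq> carrier Q"
    using H by (auto simp: maximal_filter_def proper_filter_def rl_filter_def)
  have "G = pullback H" if G: "proper_filter L G" "pullback H \<subseteq> G" for G
  proof -
    have "F \<subseteq> G"
      using pullback_proper(2)[OF proper] G(2) by blast
    moreover have "H \<subseteq> cls ` G"
      using image_pullback[OF sub] G(2) by blast
    ultimately have "cls ` G = H"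
      using H image_proper[OF G(1)] unfolding maximal_filter_def by blast
    moreover have "rl_filter L G"
      using G(1) by (simp add: proper_filter_def)
    ultimately show ?thesis
      using pullback_image \<open>F \<subseteq> G\<close> by blast
  qed
  then show ?thesis
    unfolding maximal_filter_def using pullback_proper(1)[OF proper] by blast
qed

text \<open>
  Taking preimages and taking images are inverse inclusion-preserving maps between the proper
  filters of the quotient and the proper filters above \<open>F\<close>, so they match the maximal ones.
\<close>

lemma local_quotient_iff: "local_rl Q \<longleftrightarrow> (\<exists>!M. maximal_filter L M \<and> F \<subseteq> M)"
proof -
  have "bij_betw pullback {H. maximal_filter Q H} {M. maximal_filter L M \<and> F \<subseteq> M}"
  proof (rule bij_betwI[where g = "image cls"])
    show "pullback \<in> {H. maximal_filter Q H} \<rightarrow> {M. maximal_filter L M \<and> F \<subseteq> M}"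
      using pullback_maximal pullback_proper(2) by (auto simp: maximal_filter_def[of Q])
    show "image cls \<in> {M. maximal_filter L M \<and> F \<subseteq> M} \<rightarrow> {H. maximal_filter Q H}"
      using image_maximal by blast
    show "cls ` pullback H = H" if "H \<in> {H. maximal_filter Q H}" for H
      using that image_pullback by (auto simp: maximal_filter_def proper_filter_def rl_filter_def)
    show "pullback (cls ` M) = M" if "M \<in> {M. maximal_filter L M \<and> F \<subseteq> M}" for M
      using that pullback_image maximal_is_filter by blast
  qed
  then have "card {H. maximal_filter Q H} = card {M. maximal_filter L M \<and> F \<subseteq> M}"
    by (rule bij_betw_same_card)
  then show ?thesis
    unfolding local_rl_def Ex1_iff_card by simp
qed

end

section \<open>Equivalents of the Gelfand property\<close>

context residuated_lattice
begin

text \<open>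
  This lemma and the next say that a Gelfand residuated lattice is one in which \<open>D(m) \<subseteq> n\<close> forces
  \<open>n = m\<close> for maximal \<open>m\<close> and \<open>n\<close>; the characterizations below all pass through this condition.
\<close>

lemma GelfandD:
  assumes "Gelfand L" and m: "maximal_filter L m" and n: "maximal_filter L n"
    and "D_filter L m \<subseteq> n"
  shows "n = m"
proof -
  obtain r where r: "prime_filter L r" "r \<subseteq> m" "r \<subseteq> n"
    using D_filter_subset_iff_common_prime[OF maximal_is_prime[OF m] maximal_is_prime[OF n]]
      assms(4) by auto
  have "\<exists>!M. maximal_filter L M \<and> r \<subseteq> M"
    using \<open>Gelfand L\<close> r(1) by (simp add: Gelfand_def Spec_def)
  then show ?thesis
    using m n r by metis
qed

lemma GelfandI:
  assumes "\<And>m n. \<lbrakk>maximal_filter L m; maximal_filter L n; D_filter L m \<subseteq> n\<rbrakk> \<Longrightarrow> n = m"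
  shows "Gelfand L"
  unfolding Gelfand_def
proof (intro ballI ex_ex1I)
  fix P assume "P \<in> Spec L"
  then have P: "prime_filter L P"
    by (simp add: Spec_def)
  then have "proper_filter L P"
    by (simp add: prime_filter_def)
  then show "\<exists>m. maximal_filter L m \<and> P \<subseteq> m"
    using maximal_above by blast
  fix m n assume m: "maximal_filter L m \<and> P \<subseteq> m" and n: "maximal_filter L n \<and> P \<subseteq> n"
  then have "D_filter L n \<subseteq> m"
    using P D_filter_subset_iff_common_prime[of n m] maximal_is_prime by auto
  then show "m = n"
    using assms m n by blast
qed

lemma maximal_D_subset: "maximal_filter L m \<Longrightarrow> D_filter L m \<subseteq> m"
  by (simp add: D_filter_subset_self maximal_is_prime)

lemma maximal_D_filter: "maximal_filter L m \<Longrightarrow> rl_filter L (D_filter L m)"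
  by (simp add: D_filter_is_filter maximal_is_prime)

lemma Gelfand_iff_separated:
  "Gelfand L \<longleftrightarrow> (\<forall>m n. maximal_filter L m \<and> maximal_filter L n \<and> m \<noteq> n \<longrightarrow>
    (\<exists>a \<in> carrier L - m. \<exists>b \<in> carrier L - n. a \<^bold>\<or> b = \<one>))" (is "_ \<longleftrightarrow> ?R")
proof -
  have D: "D_filter L n \<subseteq> m \<longleftrightarrow> \<not> (\<exists>a \<in> carrier L - m. \<exists>b \<in> carrier L - n. a \<^bold>\<or> b = \<one>)"
    if "maximal_filter L m" for m n
    using D_filter_subset_iff[of m n] filter_sub[OF maximal_is_filter[OF that]] by auto
  show ?thesis
  proof
    assume "Gelfand L" then show ?R
      using D GelfandD by metis
  next
    assume ?R then show "Gelfand L"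
      using D by (intro GelfandI) metis
  qed
qed

lemma Gelfand_iff_D_comaximal:
  "Gelfand L \<longleftrightarrow> (\<forall>m n. maximal_filter L m \<and> maximal_filter L n \<and> m \<noteq> n \<longrightarrow>
    comaximal L (D_filter L m) (D_filter L n))" (is "_ \<longleftrightarrow> ?R")
proof -
  have C: "comaximal L (D_filter L m) (D_filter L n) \<longleftrightarrow>
      \<not> (\<exists>k. maximal_filter L k \<and> D_filter L m \<subseteq> k \<and> D_filter L n \<subseteq> k)"
    if "maximal_filter L m" "maximal_filter L n" for m n
    using that maximal_D_filter
    by (simp add: comaximal_def filter_join_whole_iff_no_common_maximal)
  show ?thesis
  proof
    assume "Gelfand L" then show ?R
      using C GelfandD by metis
  next
    assume ?R then show "Gelfand L"
      using C maximal_D_subset by (intro GelfandI) metis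
  qed
qed

text \<open>
  Comaximality means \<open>f \<otimes> g = 0\<close> for some \<open>f \<in> F\<close>, \<open>g \<in> G\<close>, and \<open>\<^bold>\<not> f\<close> is the largest possible
  choice of \<open>g\<close>.
\<close>

lemma comaximal_iff_complement:
  assumes F: "rl_filter L F" and G: "rl_filter L G"
  shows "comaximal L F G \<longleftrightarrow> (\<exists>a \<in> carrier L. a \<in> F \<and> \<^bold>\<not> a \<in> G)"
proof -
  have "(\<exists>g\<in>G. f \<otimes> g = \<^bold>0) \<longleftrightarrow> \<^bold>\<not> f \<in> G" if f: "f \<in> carrier L" for f
  proof
    assume "\<exists>g\<in>G. f \<otimes> g = \<^bold>0"
    then obtain g where g: "g \<in> G" "f \<otimes> g = \<^bold>0" ..
    then have "g \<^bold>\<le> \<^bold>\<not> f"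
      using filter_sub[OF G g(1)] f by (simp add: le_neg_iff m_comm)
    then show "\<^bold>\<not> f \<in> G"
      using filter_up[OF G g(1)] f by (simp add: neg_closed)
  next
    assume "\<^bold>\<not> f \<in> G" then show "\<exists>g\<in>G. f \<otimes> g = \<^bold>0"
      using mult_neg[OF f] by blast
  qed
  then show ?thesis
    unfolding comaximal_def filter_join_whole_iff_zero[OF F G] using filter_sub[OF F] by auto
qed

lemma Gelfand_iff_complement:
  "Gelfand L \<longleftrightarrow> (\<forall>m n. maximal_filter L m \<and> maximal_filter L n \<and> m \<noteq> n \<longrightarrow>
    (\<exists>a \<in> carrier L. a \<in> D_filter L m \<and> \<^bold>\<not> a \<in> D_filter L n))"
  using Gelfand_iff_D_comaximal comaximal_iff_complement maximal_D_filter by simp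

text \<open>
  \<open>D\<close> reverses inclusions: if \<open>p\<close> lies in a maximal filter \<open>n\<close>, then \<open>D(n) \<subseteq> D(p)\<close>, so
  \<open>D(p) \<subseteq> m\<close> already gives \<open>D(n) \<subseteq> m\<close>.
\<close>

lemma Gelfand_iff_prime_subset:
  "Gelfand L \<longleftrightarrow> (\<forall>m p. maximal_filter L m \<and> prime_filter L p \<longrightarrow>
    D_filter L p \<subseteq> m \<longrightarrow> p \<subseteq> m)" (is "_ \<longleftrightarrow> ?R")
proof
  assume gelfand: "Gelfand L"
  show ?R
  proof (intro allI impI, elim conjE)
    fix m p assume m: "maximal_filter L m" and p: "prime_filter L p" and D: "D_filter L p \<subseteq> m"
    obtain n where n: "maximal_filter L n" "p \<subseteq> n"
      using p maximal_above unfolding prime_filter_def by blast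
    have "D_filter L n \<subseteq> D_filter L p"
      using n(2) unfolding D_filter_def by blast
    then have "m = n"
      using GelfandD[OF gelfand n(1) m] D by auto
    then show "p \<subseteq> m"
      using n by simp
  qed
next
  assume ?R then show "Gelfand L"
    using maximal_is_prime maximal_subset_eq by (intro GelfandI) metis
qed

lemma Gelfand_iff_proper_subset:
  "Gelfand L \<longleftrightarrow> (\<forall>m F. maximal_filter L m \<and> proper_filter L F \<longrightarrow>
    D_filter L m \<subseteq> F \<longrightarrow> F \<subseteq> m)" (is "_ \<longleftrightarrow> ?R")
proof
  assume gelfand: "Gelfand L"
  show ?R
  proof (intro allI impI, elim conjE)
    fix m F assume m: "maximal_filter L m" and F: "proper_filter L F" and D: "D_filter L m \<subseteq> F"
    obtain n where n: "maximal_filter L n" "F \<subseteq> n"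
      using F maximal_above by blast
    then have "n = m"
      using GelfandD[OF gelfand m n(1)] D by auto
    then show "F \<subseteq> m"
      using n by simp
  qed
next
  assume ?R then show "Gelfand L"
    using maximal_is_proper maximal_subset_eq by (intro GelfandI) metis
qed

text \<open>
  For maximal \<open>m\<close>, the equation \<open>F \<^bold>\<squnion> m = A\<close> just says \<open>\<not> F \<subseteq> m\<close>, while \<open>F \<^bold>\<squnion> D(m) = A\<close> says
  that no maximal filter contains both \<open>F\<close> and \<open>D(m)\<close>.
\<close>

lemma Gelfand_iff_join_whole:
  "Gelfand L \<longleftrightarrow> (\<forall>m F. maximal_filter L m \<and> proper_filter L F \<longrightarrow>
    F \<^bold>\<squnion> m = carrier L \<longrightarrow> F \<^bold>\<squnion> D_filter L m = carrier L)" (is "_ \<longleftrightarrow> ?R")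
proof -
  have join: "F \<^bold>\<squnion> m = carrier L \<longleftrightarrow> \<not> F \<subseteq> m"
    "F \<^bold>\<squnion> D_filter L m = carrier L \<longleftrightarrow>
      \<not> (\<exists>k. maximal_filter L k \<and> F \<subseteq> k \<and> D_filter L m \<subseteq> k)"
    if F: "proper_filter L F" and m: "maximal_filter L m" for F m
  proof -
    have "rl_filter L F"
      using F by (simp add: proper_filter_def)
    then show "F \<^bold>\<squnion> m = carrier L \<longleftrightarrow> \<not> F \<subseteq> m"
      using filter_join_whole_iff_no_common_maximal[OF _ maximal_is_filter[OF m]]
        maximal_subset_eq[OF m] m by auto
    show "F \<^bold>\<squnion> D_filter L m = carrier L \<longleftrightarrow>
      \<not> (\<exists>k. maximal_filter L k \<and> F \<subseteq> k \<and> D_filter L m \<subseteq> k)"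
      using filter_join_whole_iff_no_common_maximal[OF \<open>rl_filter L F\<close> maximal_D_filter[OF m]] .
  qed
  show ?thesis
  proof
    assume "Gelfand L" then show ?R
      using join GelfandD by metis
  next
    assume ?R then show "Gelfand L"
      using join maximal_is_proper maximal_subset_eq by (intro GelfandI) (metis order_refl)
  qed
qed

lemma Gelfand_iff_unique_maximal:
  "Gelfand L \<longleftrightarrow> (\<forall>m. maximal_filter L m \<longrightarrow>
    (\<forall>n. maximal_filter L n \<and> D_filter L m \<subseteq> n \<longleftrightarrow> n = m))" (is "_ \<longleftrightarrow> ?R")
proof
  assume "Gelfand L" then show ?R
    using GelfandD maximal_D_subset by blast
next
  assume ?R then show "Gelfand L"
    by (intro GelfandI) blast
qed

text \<open>
  A prime below \<open>m\<close> always contains \<open>D(m)\<close>; the Gelfand property supplies the converse.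
\<close>

lemma Gelfand_iff_generizations:
  "Gelfand L \<longleftrightarrow> (\<forall>m. maximal_filter L m \<longrightarrow>
    generizations L m = spec_hull L (D_filter L m))" (is "_ \<longleftrightarrow> ?R")
proof
  assume gelfand: "Gelfand L"
  have "q \<subseteq> m \<longleftrightarrow> D_filter L m \<subseteq> q" if "maximal_filter L m" "prime_filter L q" for m q
    using gelfand that D_filter_subset_generization[OF that(2)]
    unfolding Gelfand_iff_proper_subset prime_filter_def by auto
  then show ?R
    unfolding generizations_def spec_hull_def Spec_def by auto
next
  assume R: ?R
  show "Gelfand L"
  proof (rule GelfandI)
    fix m n assume m: "maximal_filter L m" and n: "maximal_filter L n" and "D_filter L m \<subseteq> n"
    then have "n \<in> spec_hull L (D_filter L m)"
      by (simp add: spec_hull_def Spec_def maximal_is_prime)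
    then have "n \<subseteq> m"
      using R m unfolding generizations_def by blast
    then show "n = m"
      using maximal_subset_eq[OF n m] by simp
  qed
qed

lemma Gelfand_iff_local_quotient:
  "Gelfand L \<longleftrightarrow> (\<forall>m. maximal_filter L m \<longrightarrow> local_rl (L \<^bold>/\<^bold>/ D_filter L m))"
proof -
  have "local_rl (L \<^bold>/\<^bold>/ D_filter L m) \<longleftrightarrow>
      (\<forall>n. maximal_filter L n \<and> D_filter L m \<subseteq> n \<longleftrightarrow> n = m)" if m: "maximal_filter L m" for m
    using filtered_rl.local_quotient_iff[OF filtered[OF maximal_D_filter[OF m]]]
      m maximal_D_subset[OF m] by metis
  then show ?thesis
    unfolding Gelfand_iff_unique_maximal by simp
qed

lemma pow_in_filter: "\<lbrakk>rl_filter L F; x \<in> F\<rbrakk> \<Longrightarrow> x [^] (n::nat) \<in> F"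
  by (induction n) (simp_all add: filter_one filter_mult)

text \<open>
  This is the filter generated by \<open>x\<close>.  Its members are witnessed by positive exponents so that
  the power of \<open>x\<close> obtained from comaximality has a positive exponent as well.
\<close>

lemma principal_filter:
  assumes x: "x \<in> carrier L"
  shows "rl_filter L {z \<in> carrier L. \<exists>n::nat. n > 0 \<and> x [^] n \<^bold>\<le> z}" (is "rl_filter L ?G")
proof (rule filterI)
  show "\<one> \<in> ?G"
    using x le_one by (auto intro: exI[of _ 1])
next
  fix u v assume "u \<in> ?G" "v \<in> ?G"
  then obtain i j :: nat where ij: "i > 0" "x [^] i \<^bold>\<le> u" "x [^] j \<^bold>\<le> v"
    and c: "u \<in> carrier L" "v \<in> carrier L" by blast
  have "x [^] i \<otimes> x [^] j \<^bold>\<le> u \<otimes> x [^] j" "u \<otimes> x [^] j \<^bold>\<le> u \<otimes> v"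
    using ij c x by (simp_all add: mult_mono_left mult_mono_right)
  then have "x [^] i \<otimes> x [^] j \<^bold>\<le> u \<otimes> v"
    by (rule le_trans) (use c x in simp_all)
  then have "x [^] (i + j) \<^bold>\<le> u \<otimes> v"
    using x by (simp add: nat_pow_mult)
  then show "u \<otimes> v \<in> ?G"
    using ij(1) c by auto
next
  fix u v assume "u \<in> ?G" and v: "u \<^bold>\<le> v" "v \<in> carrier L"
  then obtain n :: nat where n: "n > 0" "x [^] n \<^bold>\<le> u" "u \<in> carrier L" by blast
  then have "x [^] n \<^bold>\<le> v"
    using le_trans[OF n(2) v(1)] x v(2) by simp
  then show "v \<in> ?G"
    using n v by blast
qed auto

text \<open>
  The condition says that \<open>\<^bold>\<not> (x [^] n) \<in> D(m)\<close> for some \<open>n\<close>.  If \<open>x \<notin> m\<close>, then no maximal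
  filter contains both \<open>D(m)\<close> and \<open>x\<close>, so \<open>D(m)\<close> and the filter generated by \<open>x\<close> have elements
  with product \<open>0\<close>.  Conversely, a filter above \<open>D(m)\<close> that contains some \<open>x \<notin> m\<close> contains both a
  power of \<open>x\<close> and the negation of that power, hence \<open>0\<close>.
\<close>

lemma Gelfand_iff_neg_pow:
  "Gelfand L \<longleftrightarrow> (\<forall>m. maximal_filter L m \<longrightarrow>
    (\<forall>x \<in> carrier L - m. \<exists>n::nat. n > 0 \<and> (\<exists>a \<in> carrier L - m. a \<^bold>\<or> \<^bold>\<not> (x [^] n) = \<one>)))"
  (is "_ \<longleftrightarrow> ?R")
proof -
  have D: "(\<exists>a \<in> carrier L - m. a \<^bold>\<or> \<^bold>\<not> (x [^] n) = \<one>) \<longleftrightarrow> \<^bold>\<not> (x [^] n) \<in> D_filter L m"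
    if "x \<in> carrier L" for m x and n :: nat
    unfolding D_filter_def using that neg_closed join_comm by auto
  show ?thesis
  proof
    assume gelfand: "Gelfand L"
    show ?R
    proof (intro allI impI ballI)
      fix m x assume m: "maximal_filter L m" and x: "x \<in> carrier L - m"
      let ?G = "{z \<in> carrier L. \<exists>n::nat. n > 0 \<and> x [^] n \<^bold>\<le> z}"
      have G: "rl_filter L ?G"
        using principal_filter x by simp
      have "x \<in> ?G"
        using x le_refl by (auto intro: exI[of _ 1])
      then have "\<not> (\<exists>k. maximal_filter L k \<and> D_filter L m \<subseteq> k \<and> ?G \<subseteq> k)"
        using GelfandD[OF gelfand m] x by blast
      then have "comaximal L (D_filter L m) ?G"
        unfolding comaximal_def
        using filter_join_whole_iff_no_common_maximal[OF maximal_D_filter[OF m] G] by simp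
      then obtain a g where a: "a \<in> D_filter L m" and g: "g \<in> ?G" and ag: "a \<otimes> g = \<^bold>0"
        unfolding comaximal_def filter_join_whole_iff_zero[OF maximal_D_filter[OF m] G] by blast
      from g obtain n :: nat where n: "n > 0" "x [^] n \<^bold>\<le> g" and gc: "g \<in> carrier L"
        by blast
      have ac: "a \<in> carrier L" and xc: "x \<in> carrier L"
        using a x by (simp_all add: D_filter_def)
      have "a \<otimes> x [^] n \<^bold>\<le> \<^bold>0"
        using mult_mono_right[OF n(2) _ gc ac] ag xc by simp
      then have "a \<^bold>\<le> \<^bold>\<not> (x [^] n)"
        using ac xc by (simp add: rl_neg_def residuation zero_closed)
      then have "\<^bold>\<not> (x [^] n) \<in> D_filter L m"
        using filter_up[OF maximal_D_filter[OF m] a] xc by (simp add: neg_closed)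
      then show "\<exists>n::nat. n > 0 \<and> (\<exists>a \<in> carrier L - m. a \<^bold>\<or> \<^bold>\<not> (x [^] n) = \<one>)"
        using D[OF xc] n(1) by blast
    qed
  next
    assume R: ?R
    show "Gelfand L"
    proof (rule GelfandI)
      fix m n assume m: "maximal_filter L m" and n: "maximal_filter L n"
        and sub: "D_filter L m \<subseteq> n"
      have "x \<in> m" if "x \<in> n" for x
      proof (rule ccontr)
        assume "x \<notin> m"
        have x: "x \<in> carrier L"
          using filter_sub[OF maximal_is_filter[OF n] that] .
        obtain i :: nat where "\<^bold>\<not> (x [^] i) \<in> D_filter L m"
          using R m \<open>x \<notin> m\<close> x D[OF x] by blast
        then have "x [^] i \<otimes> \<^bold>\<not> (x [^] i) \<in> n"
          using sub pow_in_filter[OF maximal_is_filter[OF n] that]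
          by (intro filter_mult[OF maximal_is_filter[OF n]]) auto
        then show False
          using maximal_is_proper[OF n] x by (simp add: mult_neg proper_iff_zero_notin)
      qed
      then have "n \<subseteq> m" by blast
      then show "n = m"
        using maximal_subset_eq[OF n m] by simp
    qed
  qed
qed

end

theorem theorem3p7:
  fixes L :: "('a, 'b) rlattice_scheme" (structure)
  assumes "residuated_lattice L"
  shows
    "(Gelfand L \<longleftrightarrow>
        (\<forall>m n. maximal_filter L m \<and> maximal_filter L n \<and> m \<noteq> n \<longrightarrow>
          (\<exists>a \<in> carrier L - m. \<exists>b \<in> carrier L - n. a \<^bold>\<or> b = \<one>)))
   \<and> (Gelfand L \<longleftrightarrow>
        (\<forall>m n. maximal_filter L m \<and> maximal_filter L n \<and> m \<noteq> n \<longrightarrow>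
          comaximal L (D_filter L m) (D_filter L n)))
   \<and> (Gelfand L \<longleftrightarrow>
        (\<forall>m n. maximal_filter L m \<and> maximal_filter L n \<and> m \<noteq> n \<longrightarrow>
          (\<exists>a \<in> carrier L. a \<in> D_filter L m \<and> \<^bold>\<not> a \<in> D_filter L n)))
   \<and> (Gelfand L \<longleftrightarrow>
        (\<forall>m p. maximal_filter L m \<and> prime_filter L p \<longrightarrow>
          D_filter L p \<subseteq> m \<longrightarrow> p \<subseteq> m))
   \<and> (Gelfand L \<longleftrightarrow>
        (\<forall>m F. maximal_filter L m \<and> proper_filter L F \<longrightarrow>
          D_filter L m \<subseteq> F \<longrightarrow> F \<subseteq> m))
   \<and> (Gelfand L \<longleftrightarrow>
        (\<forall>m F. maximal_filter L m \<and> proper_filter L F \<longrightarrow>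
          F \<^bold>\<squnion> m = carrier L \<longrightarrow> F \<^bold>\<squnion> D_filter L m = carrier L))
   \<and> (Gelfand L \<longleftrightarrow>
        (\<forall>m. maximal_filter L m \<longrightarrow>
          (\<forall>n. maximal_filter L n \<and> D_filter L m \<subseteq> n \<longleftrightarrow> n = m)))
   \<and> (Gelfand L \<longleftrightarrow>
        (\<forall>m. maximal_filter L m \<longrightarrow> generizations L m = spec_hull L (D_filter L m)))
   \<and> (Gelfand L \<longleftrightarrow>
        (\<forall>m. maximal_filter L m \<longrightarrow> local_rl (L \<^bold>/\<^bold>/ D_filter L m)))
   \<and> (Gelfand L \<longleftrightarrow>
        (\<forall>m. maximal_filter L m \<longrightarrow>
          (\<forall>x \<in> carrier L - m. \<exists>n::nat. n > 0 \<and>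
            (\<exists>a \<in> carrier L - m. a \<^bold>\<or> \<^bold>\<not> (x [^] n) = \<one>))))"
proof -
  interpret residuated_lattice L
    by (rule assms)
  show ?thesis
    by (intro conjI Gelfand_iff_separated Gelfand_iff_D_comaximal Gelfand_iff_complement
        Gelfand_iff_prime_subset Gelfand_iff_proper_subset Gelfand_iff_join_whole
        Gelfand_iff_unique_maximal Gelfand_iff_generizations Gelfand_iff_local_quotient
        Gelfand_iff_neg_pow)
qed

end
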